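(* In the setting described in the context, the matrices $\bar G_{11}=W_{G,2}^\top GW_{G,2}$ and $\bar G_{21}=W_{G,1}^\top GW_{G,2}$ satisfy $$\begin{cases}\bar A_{021}+\bar A_{121}\bar G_{11}+\bar A_{122}\bar G_{21}=0,\\ \bar A_{011}+\bar A_{111}\bar G_{11}+\bar A_{112}\bar G_{21}+\bar A_{211}\bar G_{11}^2+\bar A_{212}\bar G_{21}\bar G_{11}=0,\end{cases}$$ and the matrices $\bar R_{11}=T_{R,2}RT_{R,2}^\top$ and $\bar R_{12}=T_{R,2}RT_{R,1}^\top$ satisfy $$\begin{cases}\bar A_{212}+\bar R_{11}\bar A_{112}+\bar R_{12}\bar A_{122}=0,\\ \bar A_{211}+\bar R_{11}\bar A_{111}+\bar R_{12}\bar A_{121}+\bar R_{11}^2\bar A_{011}+\bar R_{11}\bar R_{12}\bar A_{021}=0.\end{cases}$$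
   Context: Setting. Let $A_0,A_1,A_2\in\mathbb{R}^{m\times m}$, $A(z)=A_0+zA_1+z^2A_2$, with $a(z)=\det A(z)$ not identically zero. The eigenvalues of $A(z)$ are the $2m$ roots $\lambda_1,\dots,\lambda_{2m}$ of $a(z)$ counted with multiplicity ($s$ roots at infinity are added if $\deg a=2m-s$), ordered so that $|\lambda_1|\le\cdots\le|\lambda_{2m}|$. Let $1\le\ell<m$ and assume that $a(z)$ has $\ell$ distinct roots $\mu_1,\dots,\mu_\ell$ of modulus $1$, each of multiplicity $2$, and $|\lambda_{m-\ell}|<1=|\mu_1|=\cdots=|\mu_\ell|<|\lambda_{m+\ell+1}|$. Assume there exist unique solutions $G,R\in\mathbb{R}^{m\times m}$ of $A_0+A_1X+A_2X^2=0$ and $X^2A_0+XA_1+A_2=0$, respectively, such that $G$ has eigenvalues $\lambda_1,\dots,\lambda_{m-\ell},\mu_1,\dots,\mu_\ell$ and $R$ has eigenvalues $1/\lambda_{m+\ell+1},\dots,1/\lambda_{2m},1/\mu_1,\dots,1/\mu_\ell$ (with $1/\infty=0$). Let $W_{G,1}\in\mathbb{R}^{m\times(m-\ell)}$ and $\Lambda_{G,1}\in\mathbb{R}^{(m-\ell)\times(m-\ell)}$ satisfy $GW_{G,1}=W_{G,1}\Lambda_{G,1}$, $W_{G,1}^\top W_{G,1}=I_{m-\ell}$, and $\Lambda_{G,1}$ has eigenvalues $\lambda_1,\dots,\lambda_{m-\ell}$. Let $T_{R,1}\in\mathbb{R}^{(m-\ell)\times m}$ and $\Lambda_{R,1}\in\mathbb{R}^{(m-\ell)\times(m-\ell)}$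 satisfy $T_{R,1}R=\Lambda_{R,1}T_{R,1}$, $T_{R,1}T_{R,1}^\top=I_{m-\ell}$, and $\Lambda_{R,1}$ has eigenvalues $1/\lambda_{m+\ell+1},\dots,1/\lambda_{2m}$. Let $W_{G,2}\in\mathbb{R}^{m\times\ell}$ and $T_{R,2}\in\mathbb{R}^{\ell\times m}$ be such that $W_G=[\,W_{G,2}\ \ W_{G,1}\,]$ and $T_R=\begin{bmatrix} T_{R,2} \\ T_{R,1} \end{bmatrix}$ are orthogonal $m\times m$ matrices. Block notation: $\bar A_{011}=T_{R,2}A_0W_{G,2}$, $\bar A_{021}=T_{R,1}A_0W_{G,2}$, $\bar A_{111}=T_{R,2}A_1W_{G,2}$, $\bar A_{112}=T_{R,2}(A_1W_{G,1}+A_2W_{G,1}\Lambda_{G,1})$, $\bar A_{121}=(T_{R,1}A_1+\Lambda_{R,1}T_{R,1}A_0)W_{G,2}$, $\bar A_{122}=T_{R,1}(A_1W_{G,1}+A_2W_{G,1}\Lambda_{G,1})$, $\bar A_{211}=T_{R,2}A_2W_{G,2}$, $\bar A_{212}=T_{R,2}A_2W_{G,1}$. *)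

theory Defs
  imports
    "HOL-Library.Extended_Real"
    "Jordan_Normal_Form.Char_Poly"
begin

datatype ext_complex = Fin complex | Infty

fun emod :: "ext_complex \<Rightarrow> ereal" where
  "emod (Fin z) = ereal (cmod z)"
| "emod Infty = \<infinity>"

(* recip (Fin 0) is 1/0 = 0 in HOL; it is only applied to values of modulus greater than 1. *)
fun recip :: "ext_complex \<Rightarrow> complex" where
  "recip (Fin z) = 1 / z"
| "recip Infty = 0"

definition quadratic_matrix_poly :: "real mat \<Rightarrow> real mat \<Rightarrow> real mat \<Rightarrow> real poly mat" where
  "quadratic_matrix_poly A0 A1 A2 =
     map_mat (\<lambda>c. [:c:]) A0 + [:0, 1:] \<cdot>\<^sub>m map_mat (\<lambda>c. [:c:]) A1
       + [:0, 1:]^2 \<cdot>\<^sub>m map_mat (\<lambda>c. [:c:]) A2"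

definition quadratic_det_poly :: "real mat \<Rightarrow> real mat \<Rightarrow> real mat \<Rightarrow> complex poly" where
  "quadratic_det_poly A0 A1 A2 =
     map_poly complex_of_real (det (quadratic_matrix_poly A0 A1 A2))"

definition quadratic_eigenvalues ::
    "nat \<Rightarrow> real mat \<Rightarrow> real mat \<Rightarrow> real mat \<Rightarrow> ext_complex multiset" where
  "quadratic_eigenvalues m A0 A1 A2 =
     image_mset Fin (proots (quadratic_det_poly A0 A1 A2))
       + replicate_mset (2 * m - degree (quadratic_det_poly A0 A1 A2)) Infty"

(* Complex eigenvalues of a real square matrix, with algebraic multiplicity. *)
definition eigenvalue_mset :: "real mat \<Rightarrow> complex multiset" where
  "eigenvalue_mset A = proots (char_poly (map_mat complex_of_real A))"

(* The library's orthogonal_mat asks only for pairwise orthogonal nonzero columns, without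
   normalisation. *)
definition orthonormal_mat :: "nat \<Rightarrow> real mat \<Rightarrow> bool" where
  "orthonormal_mat n Q \<longleftrightarrow>
     Q \<in> carrier_mat n n \<and> transpose_mat Q * Q = 1\<^sub>m n \<and> Q * transpose_mat Q = 1\<^sub>m n"

(* The block row [A B], in the style of the library's append_rows. *)
definition append_cols :: "real mat \<Rightarrow> real mat \<Rightarrow> real mat" where
  "append_cols A B = four_block_mat A B (0\<^sub>m 0 (dim_col A)) (0\<^sub>m 0 (dim_col B))"

end

(* Two intertwining identities carry the proof: T A2 G = L T A0 for T spanning the left invariant
   subspace of R with T R = L T, and A2 W L = R A0 W for W spanning the invariant subspace of G
   with G W = W L.  The matrix equations for G and R show that in each case the difference X of
   the two sides satisfies X = B X C, where the spectrum of one of B and C lies in the open unit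
   disc and that of the other in the closed unit disc.  Such an X vanishes.  The four block
   equations are then the two matrix equations, expanded in the orthogonal bases. *)
theory Submission
  imports "Jordan_Normal_Form.Schur_Decomposition" Defs
begin

section \<open>Matrix arithmetic\<close>

(* The library versions carry dimension parameters that rewriting cannot guess; here the side
   conditions are equations between dimensions, which the simplifier decides. *)

lemma mult_assoc_dim:
  fixes A :: "'a :: semiring_0 mat"
  assumes "dim_col A = dim_row B" "dim_col B = dim_row C"
  shows "A * B * C = A * (B * C)"
  by (rule assoc_mult_mat[of A "dim_row A" "dim_row B" B "dim_row C" C "dim_col C"])
    (use assms in auto)

lemma add_mult_distrib_dim:
  fixes A :: "'a :: semiring_0 mat"
  assumes "dim_row A = dim_row B" "dim_col A = dim_col B" "dim_col B = dim_row C"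
  shows "(A + B) * C = A * C + B * C"
  by (rule add_mult_distrib_mat[of A "dim_row B" "dim_row C" B C "dim_col C"])
    (use assms in auto)

lemma mult_add_distrib_dim:
  fixes A :: "'a :: semiring_0 mat"
  assumes "dim_row B = dim_row C" "dim_col B = dim_col C" "dim_col A = dim_row C"
  shows "A * (B + C) = A * B + A * C"
  by (rule mult_add_distrib_mat[of A "dim_row A" "dim_row C" B "dim_col C" C])
    (use assms in auto)

lemma add_assoc_dim:
  fixes A :: "'a :: comm_monoid_add mat"
  assumes "dim_row A = dim_row C" "dim_col A = dim_col C"
    and "dim_row B = dim_row C" "dim_col B = dim_col C"
  shows "A + B + C = A + (B + C)"
  by (rule eq_matI) (use assms in \<open>auto simp: ac_simps\<close>)

lemma add_commute_dim:
  fixes A :: "'a :: comm_monoid_add mat"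
  assumes "dim_row A = dim_row B" "dim_col A = dim_col B"
  shows "A + B = B + A"
  by (rule eq_matI) (use assms in \<open>auto simp: ac_simps\<close>)

lemma add_left_commute_dim:
  fixes A :: "'a :: comm_monoid_add mat"
  assumes "dim_row A = dim_row C" "dim_col A = dim_col C"
    and "dim_row B = dim_row C" "dim_col B = dim_col C"
  shows "A + (B + C) = B + (A + C)"
  by (rule eq_matI) (use assms in \<open>auto simp: ac_simps\<close>)

lemmas mat_ring_dim_simps =
  mult_assoc_dim add_mult_distrib_dim mult_add_distrib_dim
  add_assoc_dim add_commute_dim add_left_commute_dim

text \<open>For an orthogonal block row this turns \<open>Q * transpose_mat Q = 1\<close> into a
  splitting of the identity into two projections, one for each group of columns.\<close>

lemma append_cols_mult_transpose:
  assumes "A \<in> carrier_mat n a" "B \<in> carrier_mat n b"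
  shows "append_cols A B * transpose_mat (append_cols A B) =
    A * transpose_mat A + B * transpose_mat B"
proof -
  have c: "transpose_mat (append_cols A B) =
      four_block_mat (transpose_mat A) (0\<^sub>m a 0) (transpose_mat B) (0\<^sub>m b 0)"
    unfolding append_cols_def
    by (subst transpose_four_block_mat[of _ n a _ b _ 0]) (use assms in auto)
  show ?thesis
    unfolding c unfolding append_cols_def
    by (subst mult_four_block_mat[of _ n a _ b _ 0 _ _ n _ 0])
      (use assms in \<open>auto intro!: eq_matI\<close>)
qed

text \<open>The counterpart for a block column: the identity splits into the projections belonging
  to the two groups of rows.\<close>

lemma transpose_mult_append_rows:
  fixes A :: "'a :: comm_semiring_0 mat"
  assumes "A \<in> carrier_mat a n" "B \<in> carrier_mat b n"
  shows "transpose_mat (append_rows A B) * append_rows A B =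
    transpose_mat A * A + transpose_mat B * B"
proof -
  have c: "transpose_mat (append_rows A B) =
      four_block_mat (transpose_mat A) (transpose_mat B) (0\<^sub>m 0 a) (0\<^sub>m 0 b)"
    unfolding append_rows_def
    by (subst transpose_four_block_mat[of _ a n _ 0 _ b]) (use assms in auto)
  show ?thesis
    unfolding c unfolding append_rows_def
    by (subst mult_four_block_mat[of _ n a _ b _ 0 _ _ n _ 0])
      (use assms in \<open>auto intro!: eq_matI\<close>)
qed

section \<open>The homogeneous Stein equation\<close>

(* Column by column in a Schur basis of B: if the columns before the j-th vanish, then the j-th
   column z satisfies z = t A z with t an eigenvalue of B, so z \<noteq> 0 would make 1/t an eigenvalue
   of A. *)
lemma stein_zero_complex:
  fixes A B X :: "complex mat"
  assumes A: "A \<in> carrier_mat n n" and B: "B \<in> carrier_mat k k" and X: "X \<in> carrier_mat n k"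
    and eq: "X = A * X * B"
    and ev: "\<And>a b. eigenvalue A a \<Longrightarrow> eigenvalue B b \<Longrightarrow> a * b \<noteq> 1"
  shows "X = 0\<^sub>m n k"
proof -
  obtain es where "char_poly B = (\<Prod>a\<leftarrow>es. [:- a, 1:])"
    using char_poly_factorized[OF B] by auto
  then obtain T where T: "T \<in> carrier_mat k k" "upper_triangular T" and sim: "similar_mat B T"
    using schur_decomposition_exists[OF B] by blast
  from sim obtain P Q where "similar_mat_wit B T P Q"
    unfolding similar_mat_def by auto
  note PQ = similar_mat_witD2[OF B this]
  have evT: "eigenvalue B (T $$ (j,j))" if "j < k" for j
  proof -
    have "T $$ (j,j) \<in> set (diag_mat T)"
      using that T by (auto simp: diag_mat_def)
    then show ?thesis
      unfolding eigenvalue_root_char_poly[OF B] char_poly_similar[OF sim]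
        char_poly_upper_triangular[OF T]
      by (auto simp: poly_prod_list prod_list_zero_iff)
  qed
  define Z where "Z = X * P"
  have Z: "Z \<in> carrier_mat n k" using X PQ by (simp add: Z_def)
  have d: "dim_row A = n" "dim_col A = n" "dim_row X = n" "dim_col X = k"
    "dim_row T = k" "dim_col T = k" "dim_row P = k" "dim_col P = k" "dim_row Q = k" "dim_col Q = k"
    "dim_row Z = n" "dim_col Z = k"
    using A X T PQ Z by auto
  have "Z = A * X * (P * T * Q) * P"
    unfolding Z_def by (subst eq) (simp add: PQ(3))
  also have "\<dots> = A * (X * P * (T * (Q * P)))"
    by (simp add: mult_assoc_dim d)
  finally have Zeq: "Z = A * (Z * T)"
    using T by (simp add: PQ(2) Z_def)
  have "col Z j = 0\<^sub>v n" if "j < k" for j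
    using that
  proof (induction j rule: less_induct)
    case (less j)
    let ?t = "T $$ (j,j)" and ?z = "col Z j"
    have z: "?z \<in> carrier_vec n" using Z by auto
    have "(Z * T) $$ (r,j) = ?t * Z $$ (r,j)" if r: "r < n" for r
    proof -
      have "(Z * T) $$ (r,j) = (\<Sum>i<k. Z $$ (r,i) * T $$ (i,j))"
        using r less.prems by (simp add: d scalar_prod_def atLeast0LessThan)
      \<comment> \<open>Terms with i < j vanish by the induction hypothesis, terms with i > j
        because \<open>T\<close> is upper triangular.\<close>
      also have "\<dots> = (\<Sum>i\<in>{j}. Z $$ (r,i) * T $$ (i,j))"
      proof (rule sum.mono_neutral_right)
        show "\<forall>i\<in>{..<k} - {j}. Z $$ (r,i) * T $$ (i,j) = 0"
        proof
          fix i assume i: "i \<in> {..<k} - {j}"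
          show "Z $$ (r,i) * T $$ (i,j) = 0"
          proof (cases "i < j")
            case True
            then have "col Z i $ r = 0" using less r by simp
            then show ?thesis using i r by (simp add: d)
          next
            case False
            then show ?thesis using i T by (auto simp: d upper_triangularD)
          qed
        qed
      qed (use less.prems in auto)
      finally show ?thesis by simp
    qed
    then have "col (Z * T) j = ?t \<cdot>\<^sub>v ?z"
      using less.prems by (intro eq_vecI) (auto simp: d)
    moreover have "?z = A *\<^sub>v col (Z * T) j"
      using less.prems by (subst Zeq, subst col_mult2[of A n n _ k]) (use A Z T in auto)
    ultimately have zA: "?z = ?t \<cdot>\<^sub>v (A *\<^sub>v ?z)"
      using mult_mat_vec[OF A z] by metis
    show ?case
    proof (rule ccontr)
      assume nz: "?z \<noteq> 0\<^sub>v n"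
      \<comment> \<open>If \<open>?t\<close> were 0, then z = t A z would already give z = 0; hence
        division by \<open>?t\<close> is legitimate below.\<close>
      have "?t \<noteq> 0"
      proof
        assume "?t = 0"
        with zA have "?z = 0 \<cdot>\<^sub>v (A *\<^sub>v ?z)" by simp
        also have "\<dots> = 0\<^sub>v n" using d by auto
        finally show False using nz by simp
      qed
      have "(1 / ?t) \<cdot>\<^sub>v ?z = (1 / ?t) \<cdot>\<^sub>v (?t \<cdot>\<^sub>v (A *\<^sub>v ?z))"
        using zA by simp
      also have "\<dots> = A *\<^sub>v ?z"
        using \<open>?t \<noteq> 0\<close> by (simp add: smult_smult_assoc)
      finally have "eigenvalue A (1 / ?t)"
        unfolding eigenvalue_def eigenvector_def using nz z by (auto simp: d)
      from ev[OF this evT[OF less.prems]] \<open>?t \<noteq> 0\<close> show False by simp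
    qed
  qed
  then have "Z = 0\<^sub>m n k"
    by (intro eq_matI) (auto simp: d simp flip: index_col)
  moreover have "X = Z * Q"
    using X by (simp add: Z_def mult_assoc_dim d PQ(1))
  ultimately show ?thesis using PQ by simp
qed

lemma set_mset_eigenvalue_mset:
  assumes "A \<in> carrier_mat n n"
  shows "set_mset (eigenvalue_mset A) = {x. eigenvalue (map_mat complex_of_real A) x}"
proof -
  have A: "map_mat complex_of_real A \<in> carrier_mat n n" using assms by simp
  \<comment> \<open>The zero polynomial has the empty multiset as its \<open>proots\<close>, so
    membership means being a root only once the polynomial is known to be nonzero.\<close>
  have "char_poly (map_mat complex_of_real A) \<noteq> 0"
    using degree_monic_char_poly[OF A] by auto
  then show ?thesis
    by (simp add: eigenvalue_mset_def eigenvalue_root_char_poly[OF A])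
qed

text \<open>A real matrix may have nonreal eigenvalues, so the triangularization takes place over
  the complex numbers. The embedding is multiplicative and injective on entries, hence vanishing
  descends to the real matrix.\<close>

lemma stein_zero:
  fixes A B X :: "real mat"
  assumes A: "A \<in> carrier_mat n n" and B: "B \<in> carrier_mat k k" and X: "X \<in> carrier_mat n k"
    and eq: "X = A * X * B"
    and ev: "\<And>a b. a \<in># eigenvalue_mset A \<Longrightarrow> b \<in># eigenvalue_mset B \<Longrightarrow> a * b \<noteq> 1"
  shows "X = 0\<^sub>m n k"
proof -
  let ?c = "map_mat complex_of_real"
  have "?c X = ?c A * ?c X * ?c B"
    using arg_cong[OF eq, of ?c] A B X
    by (simp add: of_real_hom.mat_hom_mult[of _ n n _ k] of_real_hom.mat_hom_mult[of _ n k _ k])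
  then have "?c X = 0\<^sub>m n k"
    using A B X ev
    by (intro stein_zero_complex[of "?c A" n "?c B"])
      (auto simp: set_mset_eigenvalue_mset[OF A] set_mset_eigenvalue_mset[OF B])
  then have "?c X $$ (i,j) = 0" if "i < n" "j < k" for i j
    using that by simp
  then show ?thesis
    using X by (intro eq_matI) auto
qed

text \<open>Supplies the spectral condition of the Stein equation. Strictness for one factor
  suffices, which leaves room for the unimodular eigenvalues in the other spectrum.\<close>

lemma mult_neq_1_of_norm:
  fixes a b :: complex
  assumes "cmod a < 1" "cmod b \<le> 1"
  shows "a * b \<noteq> 1"
proof -
  have "cmod (a * b) < 1"
    using mult_mono[of "cmod a" "cmod a" "cmod b" 1] assms by (simp add: norm_mult)
  then show ?thesis by auto
qed

section \<open>Intertwining identities for the solvents\<close>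

text \<open>Multiply the equation of \<open>R\<close> by \<open>T\<close> on the left and
  \<open>G\<close> on the right, and that of \<open>G\<close> by \<open>L * T\<close> on the left.
  With U and V the two sides of the claim, this gives LVG + M + U = 0 and V + M + LUG = 0 with the
  same M = L T A1 G. Subtraction yields U - V = L(U - V)G.\<close>

lemma left_invariant_intertwining:
  fixes A0 A1 A2 G R T L :: "real mat"
  assumes A: "A0 \<in> carrier_mat m m" "A1 \<in> carrier_mat m m" "A2 \<in> carrier_mat m m"
    and G: "G \<in> carrier_mat m m" "A0 + A1 * G + A2 * (G * G) = 0\<^sub>m m m"
    and R: "R \<in> carrier_mat m m" "R * R * A0 + R * A1 + A2 = 0\<^sub>m m m"
    and T: "T \<in> carrier_mat p m" "L \<in> carrier_mat p p" "T * R = L * T"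
    and evL: "\<And>a. a \<in># eigenvalue_mset L \<Longrightarrow> cmod a < 1"
    and evG: "\<And>a. a \<in># eigenvalue_mset G \<Longrightarrow> cmod a \<le> 1"
  shows "T * A2 * G = L * (T * A0)"
proof -
  have d: "dim_row A0 = m" "dim_col A0 = m" "dim_row A1 = m" "dim_col A1 = m"
    "dim_row A2 = m" "dim_col A2 = m" "dim_row G = m" "dim_col G = m" "dim_row R = m" "dim_col R = m"
    "dim_row T = p" "dim_col T = m" "dim_row L = p" "dim_col L = p"
    using A G R T by auto
  \<comment> \<open>The arbitrary right factor makes the relation applicable inside products that
    are associated to the right.\<close>
  have TR: "T * (R * Y) = L * (T * Y)" if "dim_row Y = m" for Y
    using that arg_cong[OF T(3), of "\<lambda>Z. Z * Y"] by (simp add: mult_assoc_dim d)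
  define U V where "U = T * A2 * G" and "V = L * (T * A0)"
  have UV: "U \<in> carrier_mat p m" "V \<in> carrier_mat p m"
    using A G T by (auto simp: U_def V_def)
  have "T * (R * R * A0 + R * A1 + A2) * G = 0\<^sub>m p m"
    using G T by (simp add: R(2))
  then have R': "L * V * G + L * (T * (A1 * G)) + U = 0\<^sub>m p m"
    by (simp add: U_def V_def mat_ring_dim_simps d TR)
  have "L * (T * (A0 + A1 * G + A2 * (G * G))) = 0\<^sub>m p m"
    using T by (simp add: G(2))
  then have G': "V + L * (T * (A1 * G)) + L * U * G = 0\<^sub>m p m"
    by (simp add: U_def V_def mat_ring_dim_simps d)
  \<comment> \<open>Entrywise this is the difference of \<open>R'\<close> and \<open>G'\<close>, in
    which the middle term cancels.\<close>
  have "U - V = L * U * G - L * V * G"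
  proof (rule eq_matI)
    fix i j assume "i < dim_row (L * U * G - L * V * G)" "j < dim_col (L * U * G - L * V * G)"
    then have ij: "i < p" "j < m" using UV by (auto simp: d)
    have "(L * V * G + L * (T * (A1 * G)) + U) $$ (i,j) = 0"
      "(V + L * (T * (A1 * G)) + L * U * G) $$ (i,j) = 0"
      unfolding R' G' using ij by simp_all
    then show "(U - V) $$ (i,j) = (L * U * G - L * V * G) $$ (i,j)"
      using ij UV d by (simp del: index_mult_mat(1))
  qed (use UV d in auto)
  also have "\<dots> = L * (U - V) * G"
    using UV T G
    by (simp add: mult_minus_distrib_mat[of L p p U m V] minus_mult_distrib_mat[of "L * U" p m "L * V" G m])
  finally have "U - V = 0\<^sub>m p m"
    using UV T G evL evG mult_neq_1_of_norm
    by (intro stein_zero[of L p G m]) auto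
  then have "U $$ (i,j) = V $$ (i,j)" if "i < p" "j < m" for i j
    using that UV by (metis carrier_matD eq_iff_diff_eq_0 index_minus_mat(1) index_zero_mat(1))
  then show ?thesis
    using UV unfolding U_def[symmetric] V_def[symmetric] by (intro eq_matI) auto
qed

text \<open>The mirror image: the equation of \<open>G\<close> is multiplied by \<open>R\<close> on
  the left and \<open>W\<close> on the right, that of \<open>R\<close> by \<open>W * L\<close> on
  the right. The common middle term is now R A1 W L, and U - V = R(U - V)L remains.\<close>

lemma right_invariant_intertwining:
  fixes A0 A1 A2 G R W L :: "real mat"
  assumes A: "A0 \<in> carrier_mat m m" "A1 \<in> carrier_mat m m" "A2 \<in> carrier_mat m m"
    and G: "G \<in> carrier_mat m m" "A0 + A1 * G + A2 * (G * G) = 0\<^sub>m m m"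
    and R: "R \<in> carrier_mat m m" "R * R * A0 + R * A1 + A2 = 0\<^sub>m m m"
    and W: "W \<in> carrier_mat m p" "L \<in> carrier_mat p p" "G * W = W * L"
    and evL: "\<And>a. a \<in># eigenvalue_mset L \<Longrightarrow> cmod a < 1"
    and evR: "\<And>a. a \<in># eigenvalue_mset R \<Longrightarrow> cmod a \<le> 1"
  shows "A2 * (W * L) = R * (A0 * W)"
proof -
  have d: "dim_row A0 = m" "dim_col A0 = m" "dim_row A1 = m" "dim_col A1 = m"
    "dim_row A2 = m" "dim_col A2 = m" "dim_row G = m" "dim_col G = m" "dim_row R = m" "dim_col R = m"
    "dim_row W = m" "dim_col W = p" "dim_row L = p" "dim_col L = p"
    using A G R W by auto
  have GW: "G * (W * Y) = W * (L * Y)" if "dim_row Y = p" for Y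
    using that arg_cong[OF W(3), of "\<lambda>Z. Z * Y"] by (simp add: mult_assoc_dim d)
  define U V where "U = A2 * (W * L)" and "V = R * (A0 * W)"
  have UV: "U \<in> carrier_mat m p" "V \<in> carrier_mat m p"
    using A R W by (auto simp: U_def V_def)
  have "R * ((A0 + A1 * G + A2 * (G * G)) * W) = 0\<^sub>m m p"
    using R W by (simp add: G(2))
  then have G': "V + R * (A1 * (W * L)) + R * U * L = 0\<^sub>m m p"
    by (simp add: U_def V_def mat_ring_dim_simps d GW W(3))
  have "(R * R * A0 + R * A1 + A2) * (W * L) = 0\<^sub>m m p"
    using W by (simp add: R(2))
  then have R': "R * V * L + R * (A1 * (W * L)) + U = 0\<^sub>m m p"
    by (simp add: U_def V_def mat_ring_dim_simps d)
  have "U - V = R * U * L - R * V * L"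
  proof (rule eq_matI)
    fix i j assume "i < dim_row (R * U * L - R * V * L)" "j < dim_col (R * U * L - R * V * L)"
    then have ij: "i < m" "j < p" using UV by (auto simp: d)
    have "(R * V * L + R * (A1 * (W * L)) + U) $$ (i,j) = 0"
      "(V + R * (A1 * (W * L)) + R * U * L) $$ (i,j) = 0"
      unfolding R' G' using ij by simp_all
    then show "(U - V) $$ (i,j) = (R * U * L - R * V * L) $$ (i,j)"
      using ij UV d by (simp del: index_mult_mat(1))
  qed (use UV d in auto)
  also have "\<dots> = R * (U - V) * L"
    using UV W R
    by (simp add: mult_minus_distrib_mat[of R m m U p V] minus_mult_distrib_mat[of "R * U" m p "R * V" L p])
  \<comment> \<open>The strict bound now belongs to the right factor \<open>L\<close>, so the norm
    estimate is used with its factors exchanged.\<close>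
  finally have "U - V = 0\<^sub>m m p"
    using UV W R evL evR mult_neq_1_of_norm
    by (intro stein_zero[of R m L p]) (auto, metis mult.commute)
  then have "U $$ (i,j) = V $$ (i,j)" if "i < m" "j < p" for i j
    using that UV by (metis carrier_matD eq_iff_diff_eq_0 index_minus_mat(1) index_zero_mat(1))
  then show ?thesis
    using UV unfolding U_def[symmetric] V_def[symmetric] by (intro eq_matI) auto
qed

section \<open>Moduli of the eigenvalues\<close>

text \<open>Inversion sends the exterior of the closed unit disc, with infinity included, into the
  open disc. Infinity goes to 0, and the value \<open>Fin 0\<close> is excluded by the
  hypothesis.\<close>

lemma norm_recip_less_1: "1 < emod z \<Longrightarrow> cmod (recip z) < 1"
  by (cases z) (auto simp: norm_divide divide_simps one_ereal_def)

theorem theorem4: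
  fixes m l :: nat
    and A0 A1 A2 G R :: "real mat"
    and lam :: "nat \<Rightarrow> ext_complex"
    and mu :: "nat \<Rightarrow> complex"
    and WG1 WG2 LG1 TR1 TR2 LR1 :: "real mat"
    and A011 A021 A111 A112 A121 A122 A211 A212 G11 G21 R11 R12 :: "real mat"
  assumes l: "1 \<le> l" "l < m"
    and A: "A0 \<in> carrier_mat m m" "A1 \<in> carrier_mat m m" "A2 \<in> carrier_mat m m"
    and regular: "det (quadratic_matrix_poly A0 A1 A2) \<noteq> 0"
    and lam_eigenvalues:
      "image_mset lam (mset_set {1..2 * m}) = quadratic_eigenvalues m A0 A1 A2"
    and lam_ordered: "\<And>i j. 1 \<le> i \<Longrightarrow> i \<le> j \<Longrightarrow> j \<le> 2 * m \<Longrightarrow> emod (lam i) \<le> emod (lam j)"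
    and mu_distinct: "inj_on mu {1..l}"
    and mu_unit: "\<And>i. i \<in> {1..l} \<Longrightarrow> cmod (mu i) = 1"
    and mu_double: "\<And>i. i \<in> {1..l} \<Longrightarrow> order (mu i) (quadratic_det_poly A0 A1 A2) = 2"
    and lam_inside: "emod (lam (m - l)) < 1"
    and lam_outside: "1 < emod (lam (m + l + 1))"
    and G_carrier: "G \<in> carrier_mat m m"
    and G_solution: "A0 + A1 * G + A2 * (G * G) = 0\<^sub>m m m"
    and G_eigenvalues: "image_mset Fin (eigenvalue_mset G) =
      image_mset lam (mset_set {1..m - l}) + image_mset (\<lambda>i. Fin (mu i)) (mset_set {1..l})"
    and G_unique: "\<And>X. X \<in> carrier_mat m m \<Longrightarrow> A0 + A1 * X + A2 * (X * X) = 0\<^sub>m m m \<Longrightarrow>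
      image_mset Fin (eigenvalue_mset X) =
        image_mset lam (mset_set {1..m - l}) + image_mset (\<lambda>i. Fin (mu i)) (mset_set {1..l}) \<Longrightarrow>
      X = G"
    and R_carrier: "R \<in> carrier_mat m m"
    and R_solution: "R * R * A0 + R * A1 + A2 = 0\<^sub>m m m"
    and R_eigenvalues: "eigenvalue_mset R =
      image_mset (\<lambda>i. recip (lam i)) (mset_set {m + l + 1..2 * m})
        + image_mset (\<lambda>i. 1 / mu i) (mset_set {1..l})"
    and R_unique: "\<And>X. X \<in> carrier_mat m m \<Longrightarrow> X * X * A0 + X * A1 + A2 = 0\<^sub>m m m \<Longrightarrow>
      eigenvalue_mset X =
        image_mset (\<lambda>i. recip (lam i)) (mset_set {m + l + 1..2 * m})
          + image_mset (\<lambda>i. 1 / mu i) (mset_set {1..l}) \<Longrightarrow>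
      X = R"
    and WG1_carrier: "WG1 \<in> carrier_mat m (m - l)"
    and LG1_carrier: "LG1 \<in> carrier_mat (m - l) (m - l)"
    and WG1_invariant: "G * WG1 = WG1 * LG1"
    and WG1_orthonormal: "transpose_mat WG1 * WG1 = 1\<^sub>m (m - l)"
    and LG1_eigenvalues:
      "image_mset Fin (eigenvalue_mset LG1) = image_mset lam (mset_set {1..m - l})"
    and TR1_carrier: "TR1 \<in> carrier_mat (m - l) m"
    and LR1_carrier: "LR1 \<in> carrier_mat (m - l) (m - l)"
    and TR1_invariant: "TR1 * R = LR1 * TR1"
    and TR1_orthonormal: "TR1 * transpose_mat TR1 = 1\<^sub>m (m - l)"
    and LR1_eigenvalues:
      "eigenvalue_mset LR1 = image_mset (\<lambda>i. recip (lam i)) (mset_set {m + l + 1..2 * m})"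
    and WG2_carrier: "WG2 \<in> carrier_mat m l"
    and TR2_carrier: "TR2 \<in> carrier_mat l m"
    and WG_orthogonal: "orthonormal_mat m (append_cols WG2 WG1)"
    and TR_orthogonal: "orthonormal_mat m (append_rows TR2 TR1)"
    and A011: "A011 = TR2 * A0 * WG2"
    and A021: "A021 = TR1 * A0 * WG2"
    and A111: "A111 = TR2 * A1 * WG2"
    and A112: "A112 = TR2 * (A1 * WG1 + A2 * WG1 * LG1)"
    and A121: "A121 = (TR1 * A1 + LR1 * TR1 * A0) * WG2"
    and A122: "A122 = TR1 * (A1 * WG1 + A2 * WG1 * LG1)"
    and A211: "A211 = TR2 * A2 * WG2"
    and A212: "A212 = TR2 * A2 * WG1"
    and G11: "G11 = transpose_mat WG2 * G * WG2"
    and G21: "G21 = transpose_mat WG1 * G * WG2"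
    and R11: "R11 = TR2 * R * transpose_mat TR2"
    and R12: "R12 = TR2 * R * transpose_mat TR1"
  shows "(A021 + A121 * G11 + A122 * G21 = 0\<^sub>m (m - l) l \<and>
      A011 + A111 * G11 + A112 * G21 + A211 * (G11 * G11) + A212 * G21 * G11 = 0\<^sub>m l l) \<and>
    (A212 + R11 * A112 + R12 * A122 = 0\<^sub>m l (m - l) \<and>
      A211 + R11 * A111 + R12 * A121 + R11 * R11 * A011 + R11 * R12 * A021 = 0\<^sub>m l l)"
proof -

  \<comment> \<open>Spectral bounds from the ordering and the gap at the unit circle\<close>
  have small: "emod (lam i) < 1" if "i \<in> {1..m - l}" for i
    using that le_less_trans[OF lam_ordered[of i "m - l"] lam_inside] by auto
  have large: "1 < emod (lam i)" if "i \<in> {m + l + 1..2 * m}" for i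
    using that less_le_trans[OF lam_outside lam_ordered[of "m + l + 1" i]] by auto
  have ev_LG1: "cmod a < 1" if "a \<in># eigenvalue_mset LG1" for a
  proof -
    have "Fin a \<in># image_mset lam (mset_set {1..m - l})"
      using that unfolding LG1_eigenvalues[symmetric] by simp
    then obtain i where "i \<in> {1..m - l}" "Fin a = lam i" by auto
    then have "emod (Fin a) < 1" using small by metis
    then show ?thesis by (simp add: one_ereal_def)
  qed
  have ev_G: "cmod a \<le> 1" if "a \<in># eigenvalue_mset G" for a
  proof -
    have "Fin a \<in># image_mset Fin (eigenvalue_mset G)" using that by simp
    then consider i where "i \<in> {1..m - l}" "Fin a = lam i" | i where "i \<in> {1..l}" "a = mu i"
      unfolding G_eigenvalues by auto
    then show ?thesis
    proof cases
      case 1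
      then have "emod (Fin a) < 1" using small by metis
      then show ?thesis by (simp add: one_ereal_def)
    next
      case 2
      then show ?thesis by (simp add: mu_unit)
    qed
  qed
  have ev_LR1: "cmod a < 1" if "a \<in># eigenvalue_mset LR1" for a
    using that unfolding LR1_eigenvalues by (auto intro!: norm_recip_less_1 large)
  have ev_R: "cmod a \<le> 1" if "a \<in># eigenvalue_mset R" for a
    using that unfolding R_eigenvalues
    by (auto simp: norm_divide mu_unit intro!: less_imp_le[OF norm_recip_less_1[OF large]])

  have d: "dim_row A0 = m" "dim_col A0 = m" "dim_row A1 = m" "dim_col A1 = m"
    "dim_row A2 = m" "dim_col A2 = m" "dim_row G = m" "dim_col G = m" "dim_row R = m" "dim_col R = m"
    "dim_row WG1 = m" "dim_col WG1 = m - l" "dim_row WG2 = m" "dim_col WG2 = l"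
    "dim_row TR1 = m - l" "dim_col TR1 = m" "dim_row TR2 = l" "dim_col TR2 = m"
    "dim_row LG1 = m - l" "dim_col LG1 = m - l" "dim_row LR1 = m - l" "dim_col LR1 = m - l"
    using A G_carrier R_carrier WG1_carrier WG2_carrier TR1_carrier TR2_carrier LG1_carrier LR1_carrier
    by auto
  have dB: "dim_row G11 = l" "dim_col G11 = l" "dim_row G21 = m - l" "dim_col G21 = l"
    "dim_row R11 = l" "dim_col R11 = l" "dim_row R12 = l" "dim_col R12 = m - l"
    by (simp_all add: G11 G21 R11 R12 d)
  note simps = mat_ring_dim_simps d dB

  \<comment> \<open>Coordinates of \<open>G\<close> and \<open>R\<close> in the orthogonal
    bases\<close>
  have W: "WG2 * transpose_mat WG2 + WG1 * transpose_mat WG1 = 1\<^sub>m m"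
    using WG_orthogonal append_cols_mult_transpose[OF WG2_carrier WG1_carrier]
    by (simp add: orthonormal_mat_def)
  have T: "transpose_mat TR2 * TR2 + transpose_mat TR1 * TR1 = 1\<^sub>m m"
    using TR_orthogonal transpose_mult_append_rows[OF TR2_carrier TR1_carrier]
    by (simp add: orthonormal_mat_def)
  \<comment> \<open>Inserting the splitting of the identity to the left of \<open>G * WG2\<close>
    reads off its coordinates, which are \<open>G11\<close> and \<open>G21\<close>.\<close>
  have "(WG2 * transpose_mat WG2 + WG1 * transpose_mat WG1) * (G * WG2) = WG2 * G11 + WG1 * G21"
    by (simp add: G11 G21 simps)
  then have GW2: "G * WG2 = WG2 * G11 + WG1 * G21"
    using G_carrier WG2_carrier by (simp add: W)
  have "TR2 * R * (transpose_mat TR2 * TR2 + transpose_mat TR1 * TR1) = R11 * TR2 + R12 * TR1"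
    by (simp add: R11 R12 simps)
  then have T2R: "TR2 * R = R11 * TR2 + R12 * TR1"
    using R_carrier TR2_carrier by (simp add: T)
  have GW2': "G * (WG2 * Y) = WG2 * (G11 * Y) + WG1 * (G21 * Y)" if "dim_row Y = l" for Y
    using that arg_cong[OF GW2, of "\<lambda>Z. Z * Y"] by (simp add: simps)
  have GW1': "G * (WG1 * Y) = WG1 * (LG1 * Y)" if "dim_row Y = m - l" for Y
    using that arg_cong[OF WG1_invariant, of "\<lambda>Z. Z * Y"] by (simp add: simps)
  have T2R': "TR2 * (R * Y) = R11 * (TR2 * Y) + R12 * (TR1 * Y)" if "dim_row Y = m" for Y
    using that arg_cong[OF T2R, of "\<lambda>Z. Z * Y"] by (simp add: simps)
  have T1R': "TR1 * (R * Y) = LR1 * (TR1 * Y)" if "dim_row Y = m" for Y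
    using that arg_cong[OF TR1_invariant, of "\<lambda>Z. Z * Y"] by (simp add: simps)

  \<comment> \<open>Intertwining on the invariant subspaces\<close>
  have "TR1 * A2 * G = LR1 * (TR1 * A0)"
    using A G_carrier G_solution R_carrier R_solution TR1_carrier LR1_carrier TR1_invariant ev_LR1 ev_G
    by (rule left_invariant_intertwining)
  \<comment> \<open>The factor \<open>WG2 * G11\<close> is chosen so that the left side becomes the
    \<open>A0\<close> part of \<open>A121 * G11\<close>; expanding \<open>G * WG2\<close> on the
    right gives the quadratic terms of the first equation.\<close>
  from arg_cong[OF this, of "\<lambda>Z. Z * (WG2 * G11)"]
  have keyG: "LR1 * (TR1 * (A0 * (WG2 * G11))) =
      TR1 * (A2 * (WG2 * (G11 * G11))) + TR1 * (A2 * (WG1 * (G21 * G11)))"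
    by (simp add: simps GW2')
  have keyR: "A2 * (WG1 * LG1) = R * (A0 * WG1)"
    using A G_carrier G_solution R_carrier R_solution WG1_carrier LG1_carrier WG1_invariant ev_LG1 ev_R
    by (rule right_invariant_intertwining)

  \<comment> \<open>The four block equations\<close>
  have "TR1 * ((A0 + A1 * G + A2 * (G * G)) * WG2) = 0\<^sub>m (m - l) l"
    using TR1_carrier WG2_carrier by (simp add: G_solution)
  \<comment> \<open>The terms of \<open>TR1 * A2 * G * G * WG2\<close> that are quadratic in the
    blocks of \<open>G\<close> are absorbed into \<open>A121 * G11\<close> by \<open>keyG\<close>;
    the remaining one, with \<open>LG1\<close>, belongs to \<open>A122 * G21\<close>.\<close>
  then have 1: "A021 + A121 * G11 + A122 * G21 = 0\<^sub>m (m - l) l"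
    by (simp add: A021 A121 A122 simps GW2 GW2' GW1' keyG)
  have "TR2 * ((A0 + A1 * G + A2 * (G * G)) * WG2) = 0\<^sub>m l l"
    using TR2_carrier WG2_carrier by (simp add: G_solution)
  \<comment> \<open>Pure expansion: the quadratic terms stay, and the \<open>LG1\<close> term in
    \<open>A112\<close> comes from moving \<open>G\<close> past \<open>WG1\<close>.\<close>
  then have 2: "A011 + A111 * G11 + A112 * G21 + A211 * (G11 * G11) + A212 * G21 * G11 = 0\<^sub>m l l"
    by (simp add: A011 A111 A112 A211 A212 simps GW2 GW2' GW1')
  have "TR2 * ((R * R * A0 + R * A1 + A2) * WG1) = 0\<^sub>m l (m - l)"
    using TR2_carrier WG1_carrier by (simp add: R_solution)
  \<comment> \<open>By \<open>keyR\<close> the \<open>A2\<close> parts of \<open>A112\<close> and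
    \<open>A122\<close> come from R A0 WG1, so that together they restore the term with the square
    of \<open>R\<close>.\<close>
  then have 3: "A212 + R11 * A112 + R12 * A122 = 0\<^sub>m l (m - l)"
    by (simp add: A212 A112 A122 simps T2R' T1R' keyR)
  have "TR2 * ((R * R * A0 + R * A1 + A2) * WG2) = 0\<^sub>m l l"
    using TR2_carrier WG2_carrier by (simp add: R_solution)
  \<comment> \<open>Again pure expansion: the \<open>LR1\<close> part of \<open>A121\<close> arises
    from moving the second \<open>R\<close> past \<open>TR1\<close>.\<close>
  then have 4: "A211 + R11 * A111 + R12 * A121 + R11 * R11 * A011 + R11 * R12 * A021 = 0\<^sub>m l l"
    by (simp add: A211 A111 A121 A011 A021 simps T2R' T1R')
  show ?thesis using 1 2 3 4 by blast
qed

end
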